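(* Let $S$ be an additively idempotent semiring with a zero element $0_S$ and a unity $1_S$. For every integer $n\geq 2$ the following are equivalent: (i) $\mathbf{M}_n(S)$ is subdirectly irreducible. (ii) $S$ is subdirectly irreducible.
   Context: A semiring $S(+,\cdot)$ is a non-empty set with two associative binary operations such that $+$ is commutative and $\cdot$ distributes over $+$ from both sides. It is additively idempotent if $a+a=a$ for all $a\in S$. A zero is an element $0_S$ with $a0_S=0_S=0_Sa$ and $a+0_S=a$ for all $a\in S$; a unity is an element $1_S$ with $a1_S=a=1_Sa$ for all $a\in S$. A congruence on $S$ is an equivalence relation preserved under addition and multiplication. $S$ is subdirectly irreducible if there is a least (with respect to inclusion) congruence among the congruences of $S$ different from the identity relation $id_S$; in particular at least one such congruence exists. $\mathbf{M}_n(S)$ is the semiring of all $n\times n$ matrices over $S$ with the usual addition and multiplication: $(a_{ij})+(b_{ij})=(a_{ij}+b_{ij})$, $(a_{ij})(b_{ij})=(\sum_k a_{ik}b_{kj})$. *)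

theory Defs
  imports "HOL-Algebra.Ring" "Jordan_Normal_Form.Matrix"
begin

text \<open>
  The locale \<^locale>\<open>semiring\<close> is exactly the notion of a semiring with a zero and a unity
  (with \<open>\<zero> = \<one>\<close> permitted). The notions of congruence and subdirect irreducibility only use
  the carrier, the addition and the multiplication of the structure.
\<close>

definition semiring_congruence :: "('a, 'm) ring_scheme \<Rightarrow> ('a \<times> 'a) set \<Rightarrow> bool" where
  "semiring_congruence R r \<longleftrightarrow>
     equiv (carrier R) r \<and>
     (\<forall>a b c d. (a, b) \<in> r \<longrightarrow> (c, d) \<in> r \<longrightarrow>
        (a \<oplus>\<^bsub>R\<^esub> c, b \<oplus>\<^bsub>R\<^esub> d) \<in> r \<and> (a \<otimes>\<^bsub>R\<^esub> c, b \<otimes>\<^bsub>R\<^esub> d) \<in> r)"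

definition subdirectly_irreducible :: "('a, 'm) ring_scheme \<Rightarrow> bool" where
  "subdirectly_irreducible R \<longleftrightarrow>
     (\<exists>r. semiring_congruence R r \<and> r \<noteq> Id_on (carrier R) \<and>
        (\<forall>s. semiring_congruence R s \<and> s \<noteq> Id_on (carrier R) \<longrightarrow> r \<subseteq> s))"

definition additively_idempotent :: "('a, 'm) ring_scheme \<Rightarrow> bool" where
  "additively_idempotent R \<longleftrightarrow> (\<forall>a\<in>carrier R. a \<oplus>\<^bsub>R\<^esub> a = a)"

text \<open>
  Only the type \<^typ>\<open>'a mat\<close> is taken from the matrix library: its algebraic operations come
  from type classes on \<^typ>\<open>'a\<close>, whereas here the entries are combined by the operations of \<open>R\<close>.
\<close>

definition matrix_semiring :: "nat \<Rightarrow> ('a, 'm) ring_scheme \<Rightarrow> 'a mat ring" where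
  "matrix_semiring n R =
     \<lparr>carrier = {A \<in> carrier_mat n n. \<forall>i<n. \<forall>j<n. A $$ (i, j) \<in> carrier R},
      mult = (\<lambda>A B. mat n n (\<lambda>(i, j). \<Oplus>\<^bsub>R\<^esub>k\<in>{..<n}. A $$ (i, k) \<otimes>\<^bsub>R\<^esub> B $$ (k, j))),
      one = mat n n (\<lambda>(i, j). if i = j then \<one>\<^bsub>R\<^esub> else \<zero>\<^bsub>R\<^esub>),
      zero = mat n n (\<lambda>(i, j). \<zero>\<^bsub>R\<^esub>),
      add = (\<lambda>A B. mat n n (\<lambda>(i, j). A $$ (i, j) \<oplus>\<^bsub>R\<^esub> B $$ (i, j)))\<rparr>"

end

theory Submission
  imports Defs
begin

text \<open>
  The congruences of \<open>S\<close> and of the matrix semiring correspond bijectively and monotonically, with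
  the identity relations corresponding to each other. A congruence of \<open>S\<close> is applied entrywise to
  matrices; a congruence of the matrix semiring is restricted to the matrices \<open>a E\<^sub>0\<^sub>0\<close>.
  The two maps are mutually inverse because
  \<open>E\<^sub>p\<^sub>i A E\<^sub>j\<^sub>q = A\<^sub>i\<^sub>j E\<^sub>p\<^sub>q\<close>
  and because every matrix is the sum of the matrices \<open>A\<^sub>i\<^sub>j E\<^sub>i\<^sub>j\<close>.
\<close>

section \<open>Congruences and the transfer of subdirect irreducibility\<close>

lemma semiring_congruenceD:
  assumes "semiring_congruence R r"
  shows semiring_congruence_closed: "(a, b) \<in> r \<Longrightarrow> a \<in> carrier R \<and> b \<in> carrier R"
    and semiring_congruence_refl: "a \<in> carrier R \<Longrightarrow> (a, a) \<in> r"
    and semiring_congruence_sym: "(a, b) \<in> r \<Longrightarrow> (b, a) \<in> r"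
    and semiring_congruence_trans: "(a, b) \<in> r \<Longrightarrow> (b, c) \<in> r \<Longrightarrow> (a, c) \<in> r"
    and semiring_congruence_add:
      "(a, b) \<in> r \<Longrightarrow> (c, d) \<in> r \<Longrightarrow> (a \<oplus>\<^bsub>R\<^esub> c, b \<oplus>\<^bsub>R\<^esub> d) \<in> r"
    and semiring_congruence_mult:
      "(a, b) \<in> r \<Longrightarrow> (c, d) \<in> r \<Longrightarrow> (a \<otimes>\<^bsub>R\<^esub> c, b \<otimes>\<^bsub>R\<^esub> d) \<in> r"
proof -
  have r: "r \<subseteq> carrier R \<times> carrier R" "\<forall>a\<in>carrier R. (a, a) \<in> r" "sym r" "trans r"
    using assms by (auto simp: semiring_congruence_def equiv_def refl_on_def)
  show "(a, b) \<in> r \<Longrightarrow> a \<in> carrier R \<and> b \<in> carrier R" "a \<in> carrier R \<Longrightarrow> (a, a) \<in> r"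
    using r(1,2) by auto
  show "(a, b) \<in> r \<Longrightarrow> (b, a) \<in> r" "(a, b) \<in> r \<Longrightarrow> (b, c) \<in> r \<Longrightarrow> (a, c) \<in> r"
    by (fact symD[OF r(3)], fact transD[OF r(4)])
  show "(a, b) \<in> r \<Longrightarrow> (c, d) \<in> r \<Longrightarrow> (a \<oplus>\<^bsub>R\<^esub> c, b \<oplus>\<^bsub>R\<^esub> d) \<in> r"
    "(a, b) \<in> r \<Longrightarrow> (c, d) \<in> r \<Longrightarrow> (a \<otimes>\<^bsub>R\<^esub> c, b \<otimes>\<^bsub>R\<^esub> d) \<in> r"
    using assms unfolding semiring_congruence_def by blast+
qed

lemma semiring_congruenceI:
  assumes "\<And>a b. (a, b) \<in> r \<Longrightarrow> a \<in> carrier R \<and> b \<in> carrier R"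
    and "\<And>a. a \<in> carrier R \<Longrightarrow> (a, a) \<in> r"
    and "\<And>a b. (a, b) \<in> r \<Longrightarrow> (b, a) \<in> r"
    and "\<And>a b c. (a, b) \<in> r \<Longrightarrow> (b, c) \<in> r \<Longrightarrow> (a, c) \<in> r"
    and "\<And>a b c d. (a, b) \<in> r \<Longrightarrow> (c, d) \<in> r \<Longrightarrow> (a \<oplus>\<^bsub>R\<^esub> c, b \<oplus>\<^bsub>R\<^esub> d) \<in> r"
    and "\<And>a b c d. (a, b) \<in> r \<Longrightarrow> (c, d) \<in> r \<Longrightarrow> (a \<otimes>\<^bsub>R\<^esub> c, b \<otimes>\<^bsub>R\<^esub> d) \<in> r"
  shows "semiring_congruence R r"
proof -
  have "equiv (carrier R) r"
  proof (rule equivI)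
    show "r \<subseteq> carrier R \<times> carrier R" using assms(1) by auto
    show "refl_on (carrier R) r" using assms(2) by (auto intro: refl_onI)
    show "sym r" using assms(3) by (rule symI)
    show "trans r" using assms(4) by (rule transI)
  qed
  with assms(5,6) show ?thesis by (simp add: semiring_congruence_def)
qed

lemma (in semiring) semiring_congruence_Id: "semiring_congruence R (Id_on (carrier R))"
  by (rule semiring_congruenceI) auto

text \<open>If \<open>r\<close> is least among the congruences of \<open>R\<close> other than the
  identity, then \<open>F r\<close> is least for \<open>R'\<close>. It is not the identity because
  \<open>G\<close> sends the identity to the identity while \<open>G (F r) = r\<close>. For any
  other \<open>s\<close>, the relation \<open>G s\<close> is again not the identity, so
  \<open>r\<close> lies below \<open>G s\<close> and \<open>F r\<close> below
  \<open>F (G s) = s\<close>.\<close>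

lemma subdirectly_irreducible_transfer:
  assumes F: "\<And>r. semiring_congruence R r \<Longrightarrow> semiring_congruence R' (F r)"
    and G: "\<And>s. semiring_congruence R' s \<Longrightarrow> semiring_congruence R (G s)"
    and FG: "\<And>s. semiring_congruence R' s \<Longrightarrow> F (G s) = s"
    and GF: "\<And>r. semiring_congruence R r \<Longrightarrow> G (F r) = r"
    and mono: "\<And>r t. r \<subseteq> t \<Longrightarrow> F r \<subseteq> F t"
    and F_Id: "F (Id_on (carrier R)) = Id_on (carrier R')"
    and G_Id: "G (Id_on (carrier R')) = Id_on (carrier R)"
    and "subdirectly_irreducible R"
  shows "subdirectly_irreducible R'"
proof -
  obtain r where r: "semiring_congruence R r" "r \<noteq> Id_on (carrier R)"
    and least: "\<And>s. semiring_congruence R s \<Longrightarrow> s \<noteq> Id_on (carrier R) \<Longrightarrow> r \<subseteq> s"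
    using assms(8) unfolding subdirectly_irreducible_def by blast
  have "F r \<noteq> Id_on (carrier R')"
    using GF[OF r(1)] G_Id r(2) by auto
  moreover have "F r \<subseteq> s" if "semiring_congruence R' s" "s \<noteq> Id_on (carrier R')" for s
  proof -
    have "G s \<noteq> Id_on (carrier R)"
      using FG[OF that(1)] F_Id that(2) by auto
    then show ?thesis
      using mono[OF least[OF G[OF that(1)]]] FG[OF that(1)] by simp
  qed
  ultimately show ?thesis
    unfolding subdirectly_irreducible_def using F[OF r(1)] by blast
qed

section \<open>Matrices over a semiring and the two maps between congruences\<close>

lemma in_carrier_matrix_semiring:
  "A \<in> carrier (matrix_semiring n R) \<longleftrightarrow>
     dim_row A = n \<and> dim_col A = n \<and> (\<forall>i<n. \<forall>j<n. A $$ (i, j) \<in> carrier R)"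
  by (auto simp: matrix_semiring_def)

lemma add_matrix_semiring:
  "A \<oplus>\<^bsub>matrix_semiring n R\<^esub> B = mat n n (\<lambda>(i, j). A $$ (i, j) \<oplus>\<^bsub>R\<^esub> B $$ (i, j))"
  by (simp add: matrix_semiring_def)

lemma mult_matrix_semiring:
  "A \<otimes>\<^bsub>matrix_semiring n R\<^esub> B =
     mat n n (\<lambda>(i, j). \<Oplus>\<^bsub>R\<^esub>k\<in>{..<n}. A $$ (i, k) \<otimes>\<^bsub>R\<^esub> B $$ (k, j))"
  by (simp add: matrix_semiring_def)

text \<open>Membership in the carrier fixes the dimensions of both matrices, which the condition on
  the entries leaves open.\<close>

definition entrywise :: "nat \<Rightarrow> ('a, 'm) ring_scheme \<Rightarrow> ('a \<times> 'a) set \<Rightarrow> ('a mat \<times> 'a mat) set" where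
  "entrywise n R r =
     {(A, B). A \<in> carrier (matrix_semiring n R) \<and> B \<in> carrier (matrix_semiring n R) \<and>
        (\<forall>i<n. \<forall>j<n. (A $$ (i, j), B $$ (i, j)) \<in> r)}"

text \<open>This is \<open>a\<close> times the matrix unit E_ij; it is the zero matrix if the
  position is out of range.\<close>

definition single_entry :: "nat \<Rightarrow> ('a, 'm) ring_scheme \<Rightarrow> nat \<Rightarrow> nat \<Rightarrow> 'a \<Rightarrow> 'a mat" where
  "single_entry n R i j a = mat n n (\<lambda>(k, l). if k = i \<and> l = j then a else \<zero>\<^bsub>R\<^esub>)"

text \<open>One fixed position carries all the information, since multiplication by matrix units
  moves an entry to any other position.\<close>

definition corner :: "nat \<Rightarrow> ('a, 'm) ring_scheme \<Rightarrow> ('a mat \<times> 'a mat) set \<Rightarrow> ('a \<times> 'a) set" where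
  "corner n R s =
     {(a, b). a \<in> carrier R \<and> b \<in> carrier R \<and> (single_entry n R 0 0 a, single_entry n R 0 0 b) \<in> s}"

section \<open>Matrix units and congruences of the matrix semiring\<close>

context semiring
begin

lemma single_entry_closed:
  "a \<in> carrier R \<Longrightarrow> single_entry n R i j a \<in> carrier (matrix_semiring n R)"
  by (auto simp: single_entry_def in_carrier_matrix_semiring)

lemma finsum_congruence:
  assumes r: "semiring_congruence R r" and "finite K"
    and "\<And>k. k \<in> K \<Longrightarrow> (f k, g k) \<in> r"
  shows "((\<Oplus>k\<in>K. f k), (\<Oplus>k\<in>K. g k)) \<in> r"
  using assms(2,3)
proof (induction K rule: finite_induct)
  case empty
  then show ?case by (simp add: semiring_congruence_refl[OF r])
next
  case (insert k K)
  \<comment> \<open>\<open>finsum_insert\<close> asks for summands in the carrier; they lie there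
    because \<open>r\<close> relates only carrier elements.\<close>
  have "f \<in> insert k K \<rightarrow> carrier R" "g \<in> insert k K \<rightarrow> carrier R"
    using insert.prems semiring_congruence_closed[OF r] by blast+
  with insert show ?case
    by (auto simp: finsum_insert intro!: semiring_congruence_add[OF r])
qed

lemma single_entry_mult_left:
  assumes "A \<in> carrier (matrix_semiring n R)" "i < n" "a \<in> carrier R"
  shows "single_entry n R p i a \<otimes>\<^bsub>matrix_semiring n R\<^esub> A =
    mat n n (\<lambda>(k, l). if k = p then a \<otimes> A $$ (i, l) else \<zero>)"
proof (rule eq_matI)
  fix k l
  assume "k < dim_row (mat n n (\<lambda>(k, l). if k = p then a \<otimes> A $$ (i, l) else \<zero>))"
    and "l < dim_col (mat n n (\<lambda>(k, l). if k = p then a \<otimes> A $$ (i, l) else \<zero>))"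
  then have kl: "k < n" "l < n" by auto
  have A: "A $$ (m, l) \<in> carrier R" if "m < n" for m
    using assms that kl by (auto simp: in_carrier_matrix_semiring)
  \<comment> \<open>Row \<open>k\<close> of the left factor is zero except possibly in column
    \<open>i\<close>, so only the summand \<open>m = i\<close> can survive. The sum is brought to
    the shape that \<open>finsum_singleton\<close> evaluates.\<close>
  have "(\<Oplus>m\<in>{..<n}. single_entry n R p i a $$ (k, m) \<otimes> A $$ (m, l)) =
      (\<Oplus>m\<in>{..<n}. if i = m then (if k = p then a \<otimes> A $$ (m, l) else \<zero>) else \<zero>)"
    using kl A assms by (intro finsum_cong') (auto simp: single_entry_def)
  also have "\<dots> = (if k = p then a \<otimes> A $$ (i, l) else \<zero>)"
    using A assms by (subst finsum_singleton) auto
  finally show "(single_entry n R p i a \<otimes>\<^bsub>matrix_semiring n R\<^esub> A) $$ (k, l) =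
      mat n n (\<lambda>(k, l). if k = p then a \<otimes> A $$ (i, l) else \<zero>) $$ (k, l)"
    using kl by (simp add: mult_matrix_semiring)
qed (simp_all add: mult_matrix_semiring)

lemma single_entry_mult_right:
  assumes "A \<in> carrier (matrix_semiring n R)" "j < n" "a \<in> carrier R"
  shows "A \<otimes>\<^bsub>matrix_semiring n R\<^esub> single_entry n R j q a =
    mat n n (\<lambda>(k, l). if l = q then A $$ (k, j) \<otimes> a else \<zero>)"
proof (rule eq_matI)
  fix k l
  assume "k < dim_row (mat n n (\<lambda>(k, l). if l = q then A $$ (k, j) \<otimes> a else \<zero>))"
    and "l < dim_col (mat n n (\<lambda>(k, l). if l = q then A $$ (k, j) \<otimes> a else \<zero>))"
  then have kl: "k < n" "l < n" by auto
  have A: "A $$ (k, m) \<in> carrier R" if "m < n" for m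
    using assms that kl by (auto simp: in_carrier_matrix_semiring)
  have "(\<Oplus>m\<in>{..<n}. A $$ (k, m) \<otimes> single_entry n R j q a $$ (m, l)) =
      (\<Oplus>m\<in>{..<n}. if j = m then (if l = q then A $$ (k, m) \<otimes> a else \<zero>) else \<zero>)"
    using kl A assms by (intro finsum_cong') (auto simp: single_entry_def)
  also have "\<dots> = (if l = q then A $$ (k, j) \<otimes> a else \<zero>)"
    using A assms by (subst finsum_singleton) auto
  finally show "(A \<otimes>\<^bsub>matrix_semiring n R\<^esub> single_entry n R j q a) $$ (k, l) =
      mat n n (\<lambda>(k, l). if l = q then A $$ (k, j) \<otimes> a else \<zero>) $$ (k, l)"
    using kl by (simp add: mult_matrix_semiring)
qed (simp_all add: mult_matrix_semiring)

text \<open>The left factor moves row \<open>i\<close> to row \<open>p\<close> and clears the rest,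
  the right factor does the same from column \<open>j\<close> to column \<open>q\<close>; what
  survives both is one entry.\<close>

lemma single_entry_sandwich:
  assumes A: "A \<in> carrier (matrix_semiring n R)" and "i < n" "j < n"
  shows "(single_entry n R p i \<one> \<otimes>\<^bsub>matrix_semiring n R\<^esub> A)
      \<otimes>\<^bsub>matrix_semiring n R\<^esub> single_entry n R j q \<one> = single_entry n R p q (A $$ (i, j))"
proof -
  \<comment> \<open>The intermediate product must lie in the carrier before the second factor can be
    applied. The factor \<open>\<one>\<close> stays unsimplified so that the term agrees with the
    result of \<open>single_entry_mult_left\<close>.\<close>
  have closed: "mat n n (\<lambda>(k, l). if k = p then \<one> \<otimes> A $$ (i, l) else \<zero>) \<in> carrier (matrix_semiring n R)"
    using assms by (auto simp: in_carrier_matrix_semiring)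
  show ?thesis
    unfolding single_entry_mult_left[OF A \<open>i < n\<close> one_closed]
      single_entry_mult_right[OF closed \<open>j < n\<close> one_closed]
    using assms by (intro eq_matI) (auto simp: single_entry_def in_carrier_matrix_semiring)
qed

text \<open>Together with \<open>single_entry_mult\<close> at index 0, this makes the map from
  \<open>a\<close> to \<open>a\<close> E_00 compatible with both operations.\<close>

lemma single_entry_add:
  assumes "a \<in> carrier R" "b \<in> carrier R"
  shows "single_entry n R i j a \<oplus>\<^bsub>matrix_semiring n R\<^esub> single_entry n R i j b =
    single_entry n R i j (a \<oplus> b)"
  using assms by (intro eq_matI) (auto simp: add_matrix_semiring single_entry_def)

lemma single_entry_mult:
  assumes "a \<in> carrier R" "b \<in> carrier R" "j < n"
  shows "single_entry n R i j a \<otimes>\<^bsub>matrix_semiring n R\<^esub> single_entry n R j q b =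
    single_entry n R i q (a \<otimes> b)"
  unfolding single_entry_mult_left[OF single_entry_closed[OF assms(2)] assms(3,1)]
  using assms by (intro eq_matI) (auto simp: single_entry_def)

text \<open>By reflexivity a congruence is stable under multiplication by fixed matrices, so both
  sides may be sandwiched between matrix units. The lemma serves both to bring entries to the corner
  and to send them back.\<close>

lemma congruence_single_entry:
  assumes s: "semiring_congruence (matrix_semiring n R) s"
    and AB: "(A, B) \<in> s" and "i < n" "j < n"
  shows "(single_entry n R p q (A $$ (i, j)), single_entry n R p q (B $$ (i, j))) \<in> s"
proof -
  note refl = semiring_congruence_refl[OF s single_entry_closed[OF one_closed]]
  show ?thesis
    using semiring_congruence_mult[OF s semiring_congruence_mult[OF s refl[of p i] AB] refl[of j q]]
      semiring_congruence_closed[OF s AB] assms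
    by (simp add: single_entry_sandwich)
qed

lemma congruence_if_single_entries:
  assumes s: "semiring_congruence (matrix_semiring n R) s"
    and A: "A \<in> carrier (matrix_semiring n R)" and B: "B \<in> carrier (matrix_semiring n R)"
    and entries: "\<And>i j. i < n \<Longrightarrow> j < n \<Longrightarrow>
      (single_entry n R i j (A $$ (i, j)), single_entry n R i j (B $$ (i, j))) \<in> s"
  shows "(A, B) \<in> s"
proof -
  \<comment> \<open>\<open>part P C\<close> is the partial sum of the matrices C_ij E_ij over the
    positions in \<open>P\<close>. Giving it by entries avoids finite sums in the matrix semiring,
    whose monoid laws are not established here.\<close>
  define part where "part P C = mat n n (\<lambda>p. if p \<in> P then C $$ p else \<zero>)" for P and C :: "'a mat"
  have part_insert: "part (insert (i, j) P) C =
      part P C \<oplus>\<^bsub>matrix_semiring n R\<^esub> single_entry n R i j (C $$ (i, j))"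
    \<comment> \<open>As the position is new, the partial sum is zero there, and the added matrix is
      zero everywhere else.\<close>
    if "C \<in> carrier (matrix_semiring n R)" "(i, j) \<notin> P" "i < n" "j < n" for i j P C
    using that
    by (intro eq_matI)
      (auto simp: part_def add_matrix_semiring single_entry_def in_carrier_matrix_semiring)
  have "(part P A, part P B) \<in> s" if "finite P" "P \<subseteq> {..<n} \<times> {..<n}" for P
    using that
  proof (induction P rule: finite_induct)
    case empty
    have "part {} A = part {} B" "part {} B \<in> carrier (matrix_semiring n R)"
      by (auto simp: part_def in_carrier_matrix_semiring)
    then show ?case by (simp add: semiring_congruence_refl[OF s])
  next
    case (insert p P)
    obtain i j where p: "p = (i, j)" by fastforce
    with insert have "i < n" "j < n" "(i, j) \<notin> P" "(part P A, part P B) \<in> s" by auto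
    then show ?case
      unfolding p using A B
      by (simp add: part_insert semiring_congruence_add[OF s] entries)
  qed
  from this[of "{..<n} \<times> {..<n}"] have "(part ({..<n} \<times> {..<n}) A, part ({..<n} \<times> {..<n}) B) \<in> s"
    by simp
  moreover have "part ({..<n} \<times> {..<n}) C = C" if "C \<in> carrier (matrix_semiring n R)" for C
    using that by (intro eq_matI) (auto simp: part_def in_carrier_matrix_semiring)
  ultimately show ?thesis using A B by simp
qed

section \<open>The correspondence of congruences\<close>

lemma entrywise_congruence:
  assumes r: "semiring_congruence R r"
  shows "semiring_congruence (matrix_semiring n R) (entrywise n R r)"
proof (rule semiring_congruenceI)
  fix A B C D
  assume AB: "(A, B) \<in> entrywise n R r" and CD: "(C, D) \<in> entrywise n R r"
  then show "(A \<oplus>\<^bsub>matrix_semiring n R\<^esub> C, B \<oplus>\<^bsub>matrix_semiring n R\<^esub> D) \<in> entrywise n R r"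
    by (simp add: entrywise_def in_carrier_matrix_semiring add_matrix_semiring
        semiring_congruence_add[OF r])
  have *: "((\<Oplus>k\<in>{..<n}. A $$ (i, k) \<otimes> C $$ (k, j)), (\<Oplus>k\<in>{..<n}. B $$ (i, k) \<otimes> D $$ (k, j))) \<in> r"
    if "i < n" "j < n" for i j
    using AB CD that
    by (auto simp: entrywise_def intro!: finsum_congruence[OF r] semiring_congruence_mult[OF r])
  then show "(A \<otimes>\<^bsub>matrix_semiring n R\<^esub> C, B \<otimes>\<^bsub>matrix_semiring n R\<^esub> D) \<in> entrywise n R r"
    \<comment> \<open>The relation between the entries also shows that both products have entries in
      the carrier.\<close>
    using semiring_congruence_closed[OF r *]
    by (simp add: entrywise_def in_carrier_matrix_semiring mult_matrix_semiring)
next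
  fix A B C
  assume "(A, B) \<in> entrywise n R r" "(B, C) \<in> entrywise n R r"
  then show "(A, C) \<in> entrywise n R r"
    unfolding entrywise_def using semiring_congruence_trans[OF r] by blast
next
  fix A B
  assume "(A, B) \<in> entrywise n R r"
  then show "(B, A) \<in> entrywise n R r"
    unfolding entrywise_def using semiring_congruence_sym[OF r] by blast
qed (auto simp: entrywise_def in_carrier_matrix_semiring semiring_congruence_refl[OF r])

text \<open>This is the preimage of \<open>s\<close> under \<open>single_entry n R 0 0\<close>,
  which respects both operations. For products, index 0 must be in range, hence
  \<open>n > 0\<close>.\<close>

lemma corner_congruence:
  assumes s: "semiring_congruence (matrix_semiring n R) s" and "n > 0"
  shows "semiring_congruence R (corner n R s)"
proof (rule semiring_congruenceI)
  fix a b c d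
  assume "(a, b) \<in> corner n R s" "(c, d) \<in> corner n R s"
  then have closed: "a \<in> carrier R" "b \<in> carrier R" "c \<in> carrier R" "d \<in> carrier R"
    and entries: "(single_entry n R 0 0 a, single_entry n R 0 0 b) \<in> s"
      "(single_entry n R 0 0 c, single_entry n R 0 0 d) \<in> s"
    by (auto simp: corner_def)
  note sums = semiring_congruence_add[OF s entries]
    and products = semiring_congruence_mult[OF s entries]
  show "(a \<oplus> c, b \<oplus> d) \<in> corner n R s" "(a \<otimes> c, b \<otimes> d) \<in> corner n R s"
    using sums products closed \<open>n > 0\<close>
    by (simp_all add: corner_def single_entry_add single_entry_mult)
next
  fix a b c
  assume "(a, b) \<in> corner n R s" "(b, c) \<in> corner n R s"
  then show "(a, c) \<in> corner n R s"
    unfolding corner_def using semiring_congruence_trans[OF s] by blast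
next
  fix a b
  assume "(a, b) \<in> corner n R s"
  then show "(b, a) \<in> corner n R s"
    unfolding corner_def using semiring_congruence_sym[OF s] by blast
qed (auto simp: corner_def single_entry_closed semiring_congruence_refl[OF s])

lemma corner_entrywise:
  assumes r: "semiring_congruence R r" and "n > 0"
  shows "corner n R (entrywise n R r) = r"
proof (intro equalityI subrelI)
  fix a b
  assume "(a, b) \<in> corner n R (entrywise n R r)"
  then have "(single_entry n R 0 0 a $$ (0, 0), single_entry n R 0 0 b $$ (0, 0)) \<in> r"
    using \<open>n > 0\<close> unfolding corner_def entrywise_def by blast
  with \<open>n > 0\<close> show "(a, b) \<in> r" by (simp add: single_entry_def)
next
  fix a b
  assume "(a, b) \<in> r"
  \<comment> \<open>Away from (0, 0) both matrices have entry zero, so reflexivity at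
    \<open>\<zero>\<close> settles those positions.\<close>
  then show "(a, b) \<in> corner n R (entrywise n R r)"
    using semiring_congruence_closed[OF r, of a b] semiring_congruence_refl[OF r zero_closed]
    by (auto simp: corner_def entrywise_def single_entry_closed) (auto simp: single_entry_def)
qed

lemma entrywise_corner:
  assumes s: "semiring_congruence (matrix_semiring n R) s" and "n > 0"
  shows "entrywise n R (corner n R s) = s"
proof (intro equalityI subrelI)
  fix A B
  assume AB: "(A, B) \<in> entrywise n R (corner n R s)"
  have "(single_entry n R i j (A $$ (i, j)), single_entry n R i j (B $$ (i, j))) \<in> s"
    if "i < n" "j < n" for i j
  proof -
    from AB that have
      "(single_entry n R 0 0 (A $$ (i, j)), single_entry n R 0 0 (B $$ (i, j))) \<in> s"
      by (auto simp: entrywise_def corner_def)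
    \<comment> \<open>The entry now travels from (0, 0) to (i, j), ready for the reassembly of
      \<open>A\<close> and \<open>B\<close>.\<close>
    from congruence_single_entry[OF s this \<open>n > 0\<close> \<open>n > 0\<close>, of i j] show ?thesis
      using \<open>n > 0\<close> by (simp add: single_entry_def)
  qed
  moreover have "A \<in> carrier (matrix_semiring n R)" "B \<in> carrier (matrix_semiring n R)"
    using AB by (simp_all add: entrywise_def)
  ultimately show "(A, B) \<in> s"
    by (simp add: congruence_if_single_entries[OF s])
next
  fix A B
  assume "(A, B) \<in> s"
  then show "(A, B) \<in> entrywise n R (corner n R s)"
    using semiring_congruence_closed[OF s, of A B] congruence_single_entry[OF s]
    by (auto simp: entrywise_def corner_def in_carrier_matrix_semiring)
qed

lemma entrywise_Id:
  "entrywise n R (Id_on (carrier R)) = Id_on (carrier (matrix_semiring n R))"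
proof (intro equalityI subrelI)
  fix A B
  assume *: "(A, B) \<in> entrywise n R (Id_on (carrier R))"
  then have "A = B"
    by (intro eq_matI) (auto simp: entrywise_def in_carrier_matrix_semiring Id_on_iff)
  with * show "(A, B) \<in> Id_on (carrier (matrix_semiring n R))"
    by (auto simp: entrywise_def)
qed (auto simp: entrywise_def in_carrier_matrix_semiring)

lemma subdirectly_irreducible_matrix_semiring_iff:
  assumes "n > 0"
  shows "subdirectly_irreducible (matrix_semiring n R) \<longleftrightarrow> subdirectly_irreducible R"
proof -
  \<comment> \<open>The identity on matrices is \<open>entrywise\<close> of the identity on
    \<open>R\<close>, so this is an instance of the round trip.\<close>
  have corner_Id: "corner n R (Id_on (carrier (matrix_semiring n R))) = Id_on (carrier R)"
    using corner_entrywise[OF semiring_congruence_Id assms] by (simp add: entrywise_Id)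
  have mono: "r \<subseteq> t \<Longrightarrow> corner n R r \<subseteq> corner n R t"
    "r' \<subseteq> t' \<Longrightarrow> entrywise n R r' \<subseteq> entrywise n R t'" for r t r' t'
    by (auto simp: corner_def entrywise_def)
  show ?thesis
  proof
    assume "subdirectly_irreducible (matrix_semiring n R)"
    then show "subdirectly_irreducible R"
      \<comment> \<open>\<open>F\<close> leads from the structure known to be irreducible to the
        other one; the converse direction swaps the two maps.\<close>
      by (rule subdirectly_irreducible_transfer[where F = "corner n R" and G = "entrywise n R", rotated -1])
        (simp_all add: corner_congruence entrywise_congruence corner_entrywise entrywise_corner
          corner_Id entrywise_Id mono assms)
  next
    assume "subdirectly_irreducible R"
    then show "subdirectly_irreducible (matrix_semiring n R)"
      by (rule subdirectly_irreducible_transfer[where F = "entrywise n R" and G = "corner n R", rotated -1])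
        (simp_all add: corner_congruence entrywise_congruence corner_entrywise entrywise_corner
          corner_Id entrywise_Id mono assms)
  qed
qed

end

theorem theorem2p9:
  fixes S :: "('a, 'm) ring_scheme" and n :: nat
  assumes "semiring S"
    and "additively_idempotent S"
    and "n \<ge> 2"
  shows "subdirectly_irreducible (matrix_semiring n S) \<longleftrightarrow> subdirectly_irreducible S"
  using assms by (intro semiring.subdirectly_irreducible_matrix_semiring_iff) auto

end
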